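(* Consider the cascade model with $N=3$ processors, rates $\lambda_1,\lambda_2,\lambda_3>0$ and $\beta_{12},\beta_{23}>0$, started from a fixed initial state, and let $v^*_j=\lim_{t\to\infty}x_j(t)/t$ (limit in probability). Then: (1) if $\lambda_1<\min(\lambda_2,\lambda_3)$, the limits exist and $v^*_1=v^*_2=v^*_3=\lambda_1$; (2) if $\lambda_2>\lambda_1>\lambda_3$, the limits exist and $v^*_1=v^*_2=\lambda_1$, $v^*_3=\lambda_3$; (3) if $\lambda_2<\min(\lambda_1,\lambda_3)$, the limits exist and $v^*_1=\lambda_1$, $v^*_2=v^*_3=\lambda_2$; (4) if $\lambda_1>\lambda_2>\lambda_3$, the limits exist and $v^*_1=\lambda_1$, $v^*_2=\lambda_2$, $v^*_3=\lambda_3$.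
   Context: Cascade model with $N=3$: a continuous-time process $(x_1(t),x_2(t),x_3(t))\in\mathbb Z^3$. Mutually independent Poisson flows $\Pi^k$ of intensity $\lambda_k$ ($k=1,2,3$) and $\Pi^{12},\Pi^{23}$ of intensities $\beta_{12},\beta_{23}$. At each point of $\Pi^k$, $x_k$ increases by $1$. At each point $\sigma$ of $\Pi^{k,k+1}$, processor $k$ sends to processor $k+1$ a message carrying $x_k(\sigma)$, arriving instantly; if $x_{k+1}(\sigma)>x_k(\sigma)$ then $x_{k+1}(\sigma+0)=x_k(\sigma)$. When processor $2$ is rolled back at time $\sigma$ to value $x$, all messages sent by $2$ during $(\theta,\sigma)$, where $\theta=\max\{s\le\sigma:x_2(s)=x,\ x_2(s+0)=x+1\}$, are cancelled, and if for such a cancelled message sent at time $s'$ we have $x_3(\sigma)>x_2(s')$, then $x_3$ is rolled back to $x_2(s')$ (cascading rollback). *)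

theory Defs
  imports "HOL-Probability.Probability"
begin

datatype flow = L1 | L2 | L3 | B12 | B23

definition flow_rate :: "real \<Rightarrow> real \<Rightarrow> real \<Rightarrow> real \<Rightarrow> real \<Rightarrow> flow \<Rightarrow> real" where
  "flow_rate l1 l2 l3 b12 b23 f =
     (case f of L1 \<Rightarrow> l1 | L2 \<Rightarrow> l2 | L3 \<Rightarrow> l3 | B12 \<Rightarrow> b12 | B23 \<Rightarrow> b23)"

text \<open>Sample space: omega (f,n) is the (n+1)-th inter-arrival time of flow f;
  all inter-arrival times are independent, exponential with rate of flow f.
  Hence the points of flow f form a Poisson flow of that intensity, and the
  five flows are mutually independent.\<close>
definition cascade_space :: "(flow \<Rightarrow> real) \<Rightarrow> (flow \<times> nat \<Rightarrow> real) measure" where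
  "cascade_space r = (\<Pi>\<^sub>M i\<in>UNIV. density lborel (exponential_density (r (fst i))))"

definition arr :: "(flow \<times> nat \<Rightarrow> real) \<Rightarrow> flow \<Rightarrow> nat \<Rightarrow> real" where
  "arr \<omega> f n = (\<Sum>i\<le>n. \<omega> (f, i))"

text \<open>State of the cascade: the three values, the history of unit increments of
  processor 2 (time, value before the increment), the not yet cancelled messages sent
  by processor 2 to processor 3 (send time, carried value), most recent first,
  and the number of points of each flow processed so far.\<close>
record cstate =
  cx1 :: int
  cx2 :: int
  cx3 :: int
  jumps2 :: "(real \<times> int) list"
  msgs2 :: "(real \<times> int) list"
  cnt :: "flow \<Rightarrow> nat"

definition cstep :: "flow \<Rightarrow> real \<Rightarrow> cstate \<Rightarrow> cstate" where
  "cstep f \<sigma> s = (case f of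
     L1 \<Rightarrow> s\<lparr>cx1 := cx1 s + 1\<rparr>
   | L2 \<Rightarrow> s\<lparr>jumps2 := (\<sigma>, cx2 s) # jumps2 s, cx2 := cx2 s + 1\<rparr>
   | L3 \<Rightarrow> s\<lparr>cx3 := cx3 s + 1\<rparr>
   | B23 \<Rightarrow> s\<lparr>msgs2 := (\<sigma>, cx2 s) # msgs2 s, cx3 := min (cx3 s) (cx2 s)\<rparr>
   | B12 \<Rightarrow>
       (if cx1 s < cx2 s then
          (let x = cx1 s;
               canc = (\<lambda>(s'::real, v::int). s' < \<sigma> \<and>
                        (case find (\<lambda>(tj, vj). vj = x) (jumps2 s) of
                           None \<Rightarrow> True
                         | Some (\<theta>, _) \<Rightarrow> \<theta> < s'));
               C = filter canc (msgs2 s)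
           in s\<lparr>cx2 := x,
                msgs2 := filter (\<lambda>m. \<not> canc m) (msgs2 s),
                cx3 := fold (\<lambda>(_, v) m. min m v) C (cx3 s)\<rparr>)
        else s))"

definition cinit :: "int \<times> int \<times> int \<Rightarrow> cstate" where
  "cinit x0 = \<lparr>cx1 = fst x0, cx2 = fst (snd x0), cx3 = snd (snd x0),
               jumps2 = [], msgs2 = [], cnt = (\<lambda>_. 0)\<rparr>"

definition nextf :: "(flow \<times> nat \<Rightarrow> real) \<Rightarrow> cstate \<Rightarrow> flow" where
  "nextf \<omega> s = arg_min (\<lambda>f. arr \<omega> f (cnt s f)) (\<lambda>_. True)"

fun crun :: "(flow \<times> nat \<Rightarrow> real) \<Rightarrow> int \<times> int \<times> int \<Rightarrow> nat \<Rightarrow> cstate" where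
  "crun \<omega> x0 0 = cinit x0"
| "crun \<omega> x0 (Suc k) =
     (let s = crun \<omega> x0 k; f = nextf \<omega> s
      in (cstep f (arr \<omega> f (cnt s f)) s)\<lparr>cnt := (cnt s)(f := Suc (cnt s f))\<rparr>)"

definition evtime :: "(flow \<times> nat \<Rightarrow> real) \<Rightarrow> int \<times> int \<times> int \<Rightarrow> nat \<Rightarrow> real" where
  "evtime \<omega> x0 k = (let s = crun \<omega> x0 k in arr \<omega> (nextf \<omega> s) (cnt s (nextf \<omega> s)))"

text \<open>State at time t (left-continuous convention: all points strictly before t processed).\<close>
definition cstate_at :: "(flow \<times> nat \<Rightarrow> real) \<Rightarrow> int \<times> int \<times> int \<Rightarrow> real \<Rightarrow> cstate" where
  "cstate_at \<omega> x0 t = crun \<omega> x0 (LEAST k. t \<le> evtime \<omega> x0 k)"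

definition cpos :: "int \<times> int \<times> int \<Rightarrow> nat \<Rightarrow> real \<Rightarrow> (flow \<times> nat \<Rightarrow> real) \<Rightarrow> int" where
  "cpos x0 j t \<omega> = (let s = cstate_at \<omega> x0 t in
     (if j = 1 then cx1 s else if j = 2 then cx2 s else cx3 s))"

definition conv_prob :: "'a measure \<Rightarrow> (real \<Rightarrow> 'a \<Rightarrow> real) \<Rightarrow> real \<Rightarrow> bool" where
  "conv_prob M X c \<longleftrightarrow> (\<forall>t. X t \<in> borel_measurable M) \<and>
     (\<forall>e>0. ((\<lambda>t. measure M {\<omega> \<in> space M. e < \<bar>X t \<omega> - c\<bar>}) \<longlongrightarrow> 0) at_top)"

definition speed :: "real \<Rightarrow> real \<Rightarrow> real \<Rightarrow> real \<Rightarrow> real \<Rightarrow> int \<times> int \<times> int \<Rightarrow> nat \<Rightarrow> real \<Rightarrow> bool" where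
  "speed l1 l2 l3 b12 b23 x0 j v \<longleftrightarrow>
     conv_prob (cascade_space (flow_rate l1 l2 l3 b12 b23))
               (\<lambda>t \<omega>. real_of_int (cpos x0 j t \<omega>) / t) v"

end

theory Submission
  imports Defs "HOL-Library.Discrete_Functions" "HOL-Real_Asymp.Real_Asymp"
begin

text \<open>
  Along almost every path the law of large numbers holds for all five flows, and the
  rest of the argument is deterministic. Up to an error o(t), processor 1 is at l1 t. Processor 2
  is a free counter of speed l2 that is reflected downwards at processor 1 with positive
  frequency, hence has speed min l1 l2. A cancelled message of processor 2
  carries a value above the one processor 2 is rolled back to, because processor 2 stays above
  that value after its last jump from it. So a cascading rollback never brings processor 3
  below processor 1, and processor 3 is a free counter of speed l3
  reflected at processor 2 whose extra rollbacks stay above processor 1: its speed is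
  min l3 (min l1 l2).
\<close>

text \<open>Two difficulties shape the argument. The process is a recursion over events in which a
  rollback depends on the past, so every estimate is a linear bound in the time of the k-th event,
  with an arbitrarily small error in the slope and an additive constant; bounds of this form survive
  induction over events. Reflection is studied after subtracting the points of the processor's own
  flow: what remains never increases, a lower bound for it passes from event to event, and an upper
  bound comes from the last message. Real time returns through the ratio of consecutive event times,
  which tends to 1. The other difficulty is that \<open>conv_prob\<close> asks for measurability at
  every time, although the run selects the next flow by \<open>arg_min\<close> and carries lists of
  real times.\<close>

section \<open>Law of large numbers for the flows\<close>

text \<open>Variance estimates give convergence only along a sparse subsequence. A monotone
  \<open>S\<close> at n lies between its values at the squares around n, and consecutive squares
  have ratio tending to 1, so the squares suffice.\<close>

lemma tendsto_average_if_squares: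
  fixes S :: "nat \<Rightarrow> real"
  assumes mono: "mono S" and nonneg: "\<And>n. 0 \<le> S n"
    and sq: "(\<lambda>k. S (k\<^sup>2) / real (k\<^sup>2)) \<longlonglongrightarrow> \<mu>"
  shows "(\<lambda>n. S n / real n) \<longlonglongrightarrow> \<mu>"
proof -
  let ?q = floor_sqrt
  have q: "filterlim ?q at_top sequentially"
    unfolding filterlim_at_top
  proof
    fix Z
    show "\<forall>\<^sub>F n in sequentially. Z \<le> ?q n"
      using eventually_ge_at_top[of "Z\<^sup>2"] by eventually_elim (rule le_floor_sqrtI)
  qed
  have r1: "(\<lambda>k. real (k\<^sup>2) / real ((Suc k)\<^sup>2)) \<longlonglongrightarrow> 1"
    and r2: "(\<lambda>k. real ((Suc k)\<^sup>2) / real (k\<^sup>2)) \<longlonglongrightarrow> 1"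
    unfolding of_nat_power of_nat_Suc by real_asymp+
  have lo: "(\<lambda>k. S (k\<^sup>2) / real (k\<^sup>2) * (real (k\<^sup>2) / real ((Suc k)\<^sup>2))) \<longlonglongrightarrow> \<mu>"
    using tendsto_mult[OF sq r1] by simp
  have hi: "(\<lambda>k. S ((Suc k)\<^sup>2) / real ((Suc k)\<^sup>2) * (real ((Suc k)\<^sup>2) / real (k\<^sup>2))) \<longlonglongrightarrow> \<mu>"
    using tendsto_mult[OF LIMSEQ_Suc[OF sq] r2] by simp
  show ?thesis
  proof (rule tendsto_sandwich[OF _ _ filterlim_compose[OF lo q] filterlim_compose[OF hi q]])
    show "\<forall>\<^sub>F n in sequentially. S ((?q n)\<^sup>2) / real ((?q n)\<^sup>2) *
        (real ((?q n)\<^sup>2) / real ((Suc (?q n))\<^sup>2)) \<le> S n / real n"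
      using eventually_gt_at_top[of 0]
    proof eventually_elim
      case (elim n)
      have "S ((?q n)\<^sup>2) / real ((Suc (?q n))\<^sup>2) \<le> S n / real n"
        using elim Suc_floor_sqrt_power2_gt[of n] nonneg
        by (intro frac_le monoD[OF mono]) (auto simp del: of_nat_power)
      thus ?case using elim by simp
    qed
    show "\<forall>\<^sub>F n in sequentially. S n / real n \<le> S ((Suc (?q n))\<^sup>2) / real ((Suc (?q n))\<^sup>2) *
        (real ((Suc (?q n))\<^sup>2) / real ((?q n)\<^sup>2))"
      using eventually_gt_at_top[of 0]
    proof eventually_elim
      case (elim n)
      have "S n / real n \<le> S ((Suc (?q n))\<^sup>2) / real ((?q n)\<^sup>2)"
        using elim Suc_floor_sqrt_power2_gt[of n] nonneg floor_sqrt_power2_le[of n]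
        by (intro frac_le monoD[OF mono]) (auto simp del: of_nat_power floor_sqrt_power2_le simp: of_nat_le_iff)
      thus ?case using elim by simp
    qed
  qed
qed

text \<open>Second moments suffice: the mean of n such variables has variance 1/(l^2 n), which is
  summable over the squares n. The sum of the squared deviations is then almost surely finite, so
  its terms tend to 0.\<close>

lemma (in prob_space) exponential_strong_law:
  fixes X :: "nat \<Rightarrow> 'a \<Rightarrow> real"
  assumes l: "0 < l"
    and expX: "\<And>i. distributed M lborel (X i) (exponential_density l)"
    and ind: "indep_vars (\<lambda>i. borel) X UNIV"
    and nonneg: "AE \<omega> in M. \<forall>i. 0 \<le> X i \<omega>"
  shows "AE \<omega> in M. (\<lambda>n. (\<Sum>i<n. X i \<omega>) / real n) \<longlonglongrightarrow> 1 / l"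
proof -
  define S where "S = (\<lambda>n \<omega>. \<Sum>i<n. X i \<omega>)"
  have [measurable]: "X i \<in> borel_measurable M" for i
    using expX[of i] by (auto simp: distributed_def)
  have [measurable]: "S n \<in> borel_measurable M" for n
    unfolding S_def by measurable
  have S: "distributed M lborel (S n) (erlang_density (n - 1) l)" if "0 < n" for n
    using exponential_distributed_sum[of "{..<n}" l X] l expX indep_vars_subset[OF ind] that
    unfolding S_def by auto
  \<comment> \<open>\<open>Suc k\<close> keeps the number of summands positive, as the Erlang law of
    \<open>S n\<close> requires.\<close>
  define Y where "Y = (\<lambda>k \<omega>. (S ((Suc k)\<^sup>2) \<omega> / real ((Suc k)\<^sup>2) - 1 / l)\<^sup>2)"
  have [measurable]: "Y k \<in> borel_measurable M" for k
    unfolding Y_def by measurable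
  have measurable_ennreal_Y: "(\<lambda>\<omega>. ennreal (Y k \<omega>)) \<in> borel_measurable M" for k
    by measurable
  have Y: "(\<integral>\<^sup>+ \<omega>. ennreal (Y k \<omega>) \<partial>M) = ennreal (1 / l\<^sup>2 * (1 / real ((Suc k)\<^sup>2)))" for k
  proof -
    define n where "n = (Suc k)\<^sup>2"
    have n: "0 < n" by (simp add: n_def)
    have Sn: "expectation (S n) = real n / l" "variance (S n) = real n / l\<^sup>2"
      using erlang_ith_moment[OF l S[OF n], of 1] erlang_distributed_variance[OF l S[OF n]] n
      by (simp_all add: fact_reduce)
    have int: "integrable M (\<lambda>\<omega>. S n \<omega> ^ j)" for j
      by (rule erlang_ith_moment_integrable[OF l S[OF n]])
    have int': "integrable M (\<lambda>\<omega>. (S n \<omega> - c)\<^sup>2)" for c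
      using int[of 1] int[of 2] by (simp add: power2_diff)
    have "Y k = (\<lambda>\<omega>. (S n \<omega> - real n / l)\<^sup>2 / (real n)\<^sup>2)"
      using n unfolding Y_def n_def[symmetric] by (simp add: power_divide[symmetric] diff_divide_distrib)
    moreover have "(\<integral>\<^sup>+ \<omega>. ennreal ((S n \<omega> - real n / l)\<^sup>2 / (real n)\<^sup>2) \<partial>M) =
        ennreal (variance (S n) / (real n)\<^sup>2)"
      using int' by (subst nn_integral_eq_integral) (auto simp: Sn)
    moreover have "variance (S n) / (real n)\<^sup>2 = 1 / l\<^sup>2 * (1 / real n)"
      unfolding Sn(2) using n by (simp add: power2_eq_square)
    ultimately show ?thesis by (simp add: n_def)
  qed
  have "summable (\<lambda>k. 1 / l\<^sup>2 * (1 / real ((Suc k)\<^sup>2)))"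
    using inverse_power_summable[of 2, where 'a=real]
    by (intro summable_mult) (simp add: summable_Suc_iff[of "\<lambda>k. 1 / (real k)\<^sup>2", simplified] field_simps)
  hence "(\<integral>\<^sup>+ \<omega>. (\<Sum>k. ennreal (Y k \<omega>)) \<partial>M) \<noteq> \<infinity>"
    unfolding nn_integral_suminf[OF measurable_ennreal_Y] Y infinity_ennreal_def
    by (rule ennreal_suminf_neq_top) simp
  hence "AE \<omega> in M. (\<Sum>k. ennreal (Y k \<omega>)) \<noteq> \<infinity>"
    by (intro nn_integral_PInf_AE) auto
  with nonneg show ?thesis
  proof eventually_elim
    case (elim \<omega>)
    have "summable (\<lambda>k. Y k \<omega>)"
      using elim by (intro summable_suminf_not_top) (auto simp: Y_def)
    hence "(\<lambda>k. sqrt (Y k \<omega>)) \<longlonglongrightarrow> sqrt 0"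
      by (intro tendsto_real_sqrt summable_LIMSEQ_zero)
    hence "(\<lambda>k. S ((Suc k)\<^sup>2) \<omega> / real ((Suc k)\<^sup>2) - 1 / l) \<longlonglongrightarrow> 0"
      by (simp add: Y_def tendsto_rabs_zero_iff)
    hence "(\<lambda>k. S (k\<^sup>2) \<omega> / real (k\<^sup>2)) \<longlonglongrightarrow> 1 / l"
      by (subst filterlim_sequentially_Suc[symmetric]) (rule LIM_zero_cancel)
    moreover have "mono (\<lambda>n. S n \<omega>)" "\<And>n. 0 \<le> S n \<omega>"
      using elim(1) by (auto simp: S_def intro!: monoI sum_mono2 sum_nonneg)
    ultimately show ?case
      using tendsto_average_if_squares[of "\<lambda>n. S n \<omega>"] by (simp add: S_def)
  qed
qed

text \<open>Finiteness lets \<open>arg_min\<close> in \<open>nextf\<close> attain a minimum and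
  makes the labelled states of the measurability argument countable.\<close>

instance flow :: finite
proof
  have "(UNIV :: flow set) = {L1, L2, L3, B12, B23}"
    using flow.exhaust by blast
  thus "finite (UNIV :: flow set)" by (metis finite.emptyI finite_insert)
qed

lemma flow_rate_pos:
  assumes "0 < l1" "0 < l2" "0 < l3" "0 < b12" "0 < b23"
  shows "0 < flow_rate l1 l2 l3 b12 b23 f"
  using assms by (cases f) (auto simp: flow_rate_def)

context
  fixes r :: "flow \<Rightarrow> real"
  assumes r: "\<And>f. 0 < r f"
begin

lemma prob_space_cascade_space: "prob_space (cascade_space r)"
  unfolding cascade_space_def by (intro prob_space_PiM prob_space_exponential_density r)

lemma measurable_coordinate [measurable]: "(\<lambda>\<omega>. \<omega> i) \<in> borel_measurable (cascade_space r)"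
  unfolding cascade_space_def by measurable

lemma distr_cascade_coordinate:
  "distr (cascade_space r) borel (\<lambda>\<omega>. \<omega> i) = density lborel (exponential_density (r (fst i)))"
  (is "?L = ?R")
proof -
  have "?L = distr (cascade_space r) ?R (\<lambda>\<omega>. \<omega> i)"
    by (intro distr_cong) auto
  also have "\<dots> = ?R"
    unfolding cascade_space_def
    using r by (subst distr_PiM_component) (auto intro: prob_space_exponential_density)
  finally show ?thesis .
qed

lemma distributed_cascade_coordinate:
  "distributed (cascade_space r) lborel (\<lambda>\<omega>. \<omega> i) (exponential_density (r (fst i)))"
proof -
  have "distr (cascade_space r) lborel (\<lambda>\<omega>. \<omega> i) = distr (cascade_space r) borel (\<lambda>\<omega>. \<omega> i)"
    by (intro distr_cong) auto
  thus ?thesis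
    by (auto simp: distributed_def distr_cascade_coordinate)
qed

lemma indep_cascade_flow:
  "prob_space.indep_vars (cascade_space r) (\<lambda>_. borel) (\<lambda>n \<omega>. \<omega> (f, n)) UNIV"
proof -
  interpret prob_space "cascade_space r" by (rule prob_space_cascade_space)
  let ?D = "\<lambda>i :: flow \<times> nat. density lborel (exponential_density (r (fst i)))"
  have "distr (cascade_space r) (PiM UNIV (\<lambda>_. borel)) (\<lambda>\<omega>. \<lambda>n\<in>UNIV. \<omega> (f, n)) =
      distr (cascade_space r) (PiM UNIV (\<lambda>n. ?D (f, n))) (\<lambda>\<omega>. \<lambda>n\<in>UNIV. \<omega> (f, n))"
    by (intro distr_cong sets_PiM_cong) auto
  also have "\<dots> = PiM UNIV (\<lambda>n. ?D (f, n))"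
    unfolding cascade_space_def using r
    by (intro distr_PiM_reindex) (auto intro: prob_space_exponential_density simp: inj_on_def)
  finally show ?thesis
    by (subst indep_vars_iff_distr_eq_PiM') (auto simp: distr_cascade_coordinate)
qed

lemma AE_cascade_pos: "AE \<omega> in cascade_space r. \<forall>i. 0 < \<omega> i"
proof -
  have "AE \<omega> in cascade_space r. 0 < \<omega> i" for i
  proof -
    have "AE x in density lborel (exponential_density (r (fst i))). 0 < x"
      using r AE_lborel_singleton[of "0::real"]
      by (auto simp: AE_density exponential_density_def)
    thus ?thesis
      unfolding cascade_space_def using r
      by (intro AE_PiM_component) (auto intro: prob_space_exponential_density)
  qed
  thus ?thesis by (subst AE_all_countable) auto
qed

lemma AE_arr_strong_law:
  "AE \<omega> in cascade_space r. \<forall>f. (\<lambda>n. arr \<omega> f n / real (Suc n)) \<longlonglongrightarrow> 1 / r f"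
proof -
  interpret prob_space "cascade_space r" by (rule prob_space_cascade_space)
  have "AE \<omega> in cascade_space r. (\<lambda>n. arr \<omega> f n / real (Suc n)) \<longlonglongrightarrow> 1 / r f" for f
  proof -
    have "distributed (cascade_space r) lborel (\<lambda>\<omega>. \<omega> (f, n)) (exponential_density (r f))" for n
      using distributed_cascade_coordinate[of "(f, n)"] by simp
    moreover have "AE \<omega> in cascade_space r. \<forall>n. 0 \<le> \<omega> (f, n)"
      using AE_cascade_pos by eventually_elim (auto intro: less_imp_le)
    ultimately have "AE \<omega> in cascade_space r. (\<lambda>n. (\<Sum>i<n. \<omega> (f, i)) / real n) \<longlonglongrightarrow> 1 / r f"
      by (intro exponential_strong_law r indep_cascade_flow)
    thus ?thesis
    proof eventually_elim
      case (elim \<omega>)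
      from LIMSEQ_Suc[OF this] show ?case by (simp add: arr_def lessThan_Suc_atMost)
    qed
  qed
  hence "AE \<omega> in cascade_space r. \<forall>f\<in>{L1, L2, L3, B12, B23}.
      (\<lambda>n. arr \<omega> f n / real (Suc n)) \<longlonglongrightarrow> 1 / r f"
    by simp
  thus ?thesis
    by eventually_elim (metis flow.exhaust insert_iff)
qed

end

section \<open>Almost sure behaviour of a path\<close>

lemma arr_nextf_le: "arr \<omega> (nextf \<omega> s) (cnt s (nextf \<omega> s)) \<le> arr \<omega> f (cnt s f)"
  using arg_min_least[of UNIV f "\<lambda>f. arr \<omega> f (cnt s f)"]
  by (simp add: nextf_def arg_min_on_def)

section \<open>Cascading rollbacks and the messages of processor 2\<close>

lemma fold_min_snd_le: "fold (\<lambda>(_, v) m. min m v) C (x :: int) \<le> x"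
proof (induction C arbitrary: x)
  case (Cons a C)
  show ?case using Cons[of "min x (snd a)"] by (cases a) simp
qed simp

lemma fold_min_snd_ge:
  assumes "\<And>m. m \<in> set C \<Longrightarrow> b \<le> snd m"
  shows "min x b \<le> fold (\<lambda>(_, v) m. min m v) C (x :: int)"
  using assms
proof (induction C arbitrary: x)
  case (Cons a C)
  have "min x b \<le> min (min x (snd a)) b" using Cons.prems[of a] by auto
  also have "\<dots> \<le> fold (\<lambda>(_, v) m. min m v) C (min x (snd a))"
    using Cons.prems by (intro Cons.IH) simp
  finally show ?case by (cases a) simp
qed simp

text \<open>The latest jump stands first in \<open>jumps2\<close>, so \<open>find\<close> returns
  the start \<theta> of the cancellation window. If there was no jump from x and processor 2 is
  above x now, then it has been above x from the start, because it rises by unit steps;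
  \<open>None\<close> therefore lets every message count.\<close>

definition sent_after_last_jump :: "cstate \<Rightarrow> int \<Rightarrow> real \<times> int \<Rightarrow> bool" where
  "sent_after_last_jump s x m \<longleftrightarrow> (case find (\<lambda>(tj, vj). vj = x) (jumps2 s) of
      None \<Rightarrow> True | Some (\<theta>, _) \<Rightarrow> \<theta> < fst m)"

lemma cstep_B12:
  "cstep B12 \<sigma> s = (if cx1 s < cx2 s then
     s\<lparr>cx2 := cx1 s,
       msgs2 := filter (\<lambda>m. \<not> (fst m < \<sigma> \<and> sent_after_last_jump s (cx1 s) m)) (msgs2 s),
       cx3 := fold (\<lambda>(_, v) m. min m v)
         (filter (\<lambda>m. fst m < \<sigma> \<and> sent_after_last_jump s (cx1 s) m) (msgs2 s)) (cx3 s)\<rparr>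
     else s)"
proof -
  have eq: "(\<lambda>(s'::real, v::int). s' < \<sigma> \<and> (case find (\<lambda>(tj, vj). vj = cx1 s) (jumps2 s) of
      None \<Rightarrow> True | Some (\<theta>, _) \<Rightarrow> \<theta> < s')) =
    (\<lambda>m. fst m < \<sigma> \<and> sent_after_last_jump s (cx1 s) m)"
    unfolding sent_after_last_jump_def case_prod_beta ..
  show ?thesis
    unfolding cstep_def Let_def flow.case eq ..
qed

text \<open>Processor 2 stays above x after its last jump from x, as long as it has not
  been rolled back to x or below.\<close>
definition msgs_above :: "cstate \<Rightarrow> bool" where
  "msgs_above s \<longleftrightarrow> (\<forall>x<cx2 s. \<forall>m\<in>set (msgs2 s). sent_after_last_jump s x m \<longrightarrow> x < snd m)"

lemma msgs_above_cstep:
  assumes "msgs_above s" and "\<And>m. m \<in> set (msgs2 s) \<Longrightarrow> fst m \<le> \<sigma>"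
  shows "msgs_above (cstep f \<sigma> s)"
proof (cases f)
  case B12
  thus ?thesis using assms
    by (auto simp: cstep_B12 msgs_above_def sent_after_last_jump_def)
qed (use assms in \<open>fastforce simp: cstep_def msgs_above_def sent_after_last_jump_def split: if_splits\<close>)+

lemma cx3_cstep_B12_ge:
  assumes "msgs_above s"
  shows "min (cx3 s) (cx1 s) \<le> cx3 (cstep B12 \<sigma> s)"
proof (cases "cx1 s < cx2 s")
  case True
  thus ?thesis using assms
    by (simp add: cstep_B12 msgs_above_def) (rule fold_min_snd_ge, auto intro: less_imp_le)
qed (simp add: cstep_B12)

lemma cx3_cstep_B12_le: "cx3 (cstep B12 \<sigma> s) \<le> cx3 s"
  by (simp add: cstep_B12 fold_min_snd_le)

section \<open>Event times and point counts along one path\<close>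

locale cascade_path =
  fixes \<omega> :: "flow \<times> nat \<Rightarrow> real" and r :: "flow \<Rightarrow> real"
  assumes pos: "\<And>i. 0 < \<omega> i" and rate_pos: "\<And>f. 0 < r f"
    and arr_average: "\<And>f. (\<lambda>n. arr \<omega> f n / real (Suc n)) \<longlonglongrightarrow> 1 / r f"
begin

context
  fixes x0 :: "int \<times> int \<times> int"
begin

text \<open>\<open>st k\<close> is the state just before event k, and \<open>\<tau> k\<close> is the
  time of that event. So \<open>\<tau> k\<close> is not before any point processed in
  \<open>st k\<close> and not after any point still to come.\<close>

abbreviation "st \<equiv> crun \<omega> x0"
abbreviation "\<tau> \<equiv> evtime \<omega> x0"
abbreviation "fl k \<equiv> nextf \<omega> (st k)"
abbreviation "ct k f \<equiv> real (cnt (st k) f)"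

lemma arr_mono: "m \<le> n \<Longrightarrow> arr \<omega> f m \<le> arr \<omega> f n"
  unfolding arr_def using pos by (intro sum_mono2) (auto intro: less_imp_le)

lemma arr_pos: "0 < arr \<omega> f n"
  unfolding arr_def using pos by (intro sum_pos) auto

lemma evtime_eq: "\<tau> k = arr \<omega> (fl k) (cnt (st k) (fl k))"
  by (simp add: evtime_def Let_def)

lemma evtime_le_arr: "\<tau> k \<le> arr \<omega> f (cnt (st k) f)"
  unfolding evtime_eq by (rule arr_nextf_le)

lemma evtime_pos: "0 < \<tau> k"
  by (simp add: evtime_eq arr_pos)

lemma crun_Suc_eq: "st (Suc k) = (cstep (fl k) (\<tau> k) (st k))
    \<lparr>cnt := (cnt (st k))(fl k := Suc (cnt (st k) (fl k)))\<rparr>"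
  by (simp add: Let_def evtime_eq)

declare crun.simps(2) [simp del]

lemma cnt_crun_Suc: "cnt (st (Suc k)) = (cnt (st k))(fl k := Suc (cnt (st k) (fl k)))"
  by (simp add: crun_Suc_eq)

lemma mono_evtime: "mono \<tau>"
proof (rule mono_iff_le_Suc[THEN iffD2, rule_format])
  fix k
  have "\<tau> k \<le> arr \<omega> (fl (Suc k)) (cnt (st k) (fl (Suc k)))"
    by (rule evtime_le_arr)
  also have "\<dots> \<le> \<tau> (Suc k)"
    unfolding evtime_eq[of "Suc k"] by (intro arr_mono) (simp add: cnt_crun_Suc)
  finally show "\<tau> k \<le> \<tau> (Suc k)" .
qed

lemma arr_processed:
  assumes "n < cnt (st k) f"
  shows "\<exists>j<k. arr \<omega> f n = \<tau> j"
  using assms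
proof (induction k)
  case 0
  thus ?case by (simp add: cinit_def)
next
  case (Suc k)
  show ?case
  proof (cases "n < cnt (st k) f")
    case True
    thus ?thesis using Suc.IH less_Suc_eq by blast
  next
    case False
    hence "f = fl k" "n = cnt (st k) f"
      using Suc.prems by (auto simp: cnt_crun_Suc split: if_splits)
    thus ?thesis by (auto simp: evtime_eq)
  qed
qed

lemma arr_processed_le:
  assumes "n < cnt (st k) f"
  shows "arr \<omega> f n \<le> \<tau> k"
  using arr_processed[OF assms] monoD[OF mono_evtime] by fastforce

lemma sum_cnt: "(\<Sum>f\<in>UNIV. cnt (st k) f) = k"
proof (induction k)
  case 0
  show ?case by (simp add: cinit_def)
next
  case (Suc k)
  have "(\<Sum>f\<in>UNIV. cnt (st (Suc k)) f) =
      (\<Sum>f\<in>UNIV. cnt (st k) f + (if f = fl k then 1 else 0))"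
    by (intro sum.cong) (auto simp: cnt_crun_Suc)
  also have "\<dots> = Suc k"
    using Suc by (simp add: sum.distrib finite)
  finally show ?case .
qed

lemma last_event:
  assumes "0 < cnt (st k) f"
  shows "\<exists>j<k. fl j = f \<and> cnt (st k) f = Suc (cnt (st j) f)"
  using assms
proof (induction k)
  case 0
  thus ?case by (simp add: cinit_def)
next
  case (Suc k)
  show ?case
  proof (cases "fl k = f")
    case True
    thus ?thesis by (auto simp: cnt_crun_Suc)
  next
    case False
    hence "cnt (st (Suc k)) f = cnt (st k) f" by (simp add: cnt_crun_Suc)
    thus ?thesis using Suc less_Suc_eq by auto
  qed
qed

text \<open>A bound for every k, with a constant that absorbs an initial segment, can be carried by
  induction over events, unlike a limit of \<open>x k / \<tau> k\<close>. The two bounds together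
  give that limit.\<close>

definition rate_le :: "(nat \<Rightarrow> real) \<Rightarrow> real \<Rightarrow> bool" where
  "rate_le x \<mu> \<longleftrightarrow> (\<forall>\<epsilon>>0. \<exists>C\<ge>0. \<forall>k. x k \<le> (\<mu> + \<epsilon>) * \<tau> k + C)"

definition rate_ge :: "(nat \<Rightarrow> real) \<Rightarrow> real \<Rightarrow> bool" where
  "rate_ge x \<mu> \<longleftrightarrow> (\<forall>\<epsilon>>0. \<exists>C\<ge>0. \<forall>k. (\<mu> - \<epsilon>) * \<tau> k - C \<le> x k)"

lemma arr_rate:
  assumes "0 < \<epsilon>"
  shows "\<exists>C\<ge>0. \<forall>n. \<bar>real (Suc n) - r f * arr \<omega> f n\<bar> \<le> \<epsilon> * arr \<omega> f n + C"
proof -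
  let ?d = "\<lambda>n. \<bar>real (Suc n) - r f * arr \<omega> f n\<bar>"
  have "(\<lambda>n. inverse (arr \<omega> f n / real (Suc n))) \<longlonglongrightarrow> inverse (1 / r f)"
    using rate_pos[of f] by (intro tendsto_inverse arr_average) auto
  hence "(\<lambda>n. real (Suc n) / arr \<omega> f n) \<longlonglongrightarrow> r f" by simp
  then obtain N where N: "\<And>n. n \<ge> N \<Longrightarrow> \<bar>real (Suc n) / arr \<omega> f n - r f\<bar> < \<epsilon>"
    using assms by (auto simp: LIMSEQ_iff)
  \<comment> \<open>The constant is the total error of the finitely many indices below N.\<close>
  have "?d n \<le> \<epsilon> * arr \<omega> f n + sum ?d {..<N}" for n
  proof (cases "n < N")
    case True
    hence "?d n \<le> sum ?d {..<N}" by (intro member_le_sum) auto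
    moreover have "0 \<le> \<epsilon> * arr \<omega> f n"
      using assms arr_pos[of f n] by simp
    ultimately show ?thesis by linarith
  next
    case False
    have "?d n = \<bar>real (Suc n) / arr \<omega> f n - r f\<bar> * arr \<omega> f n"
      using arr_pos[of f n] by (subst abs_mult_pos) (auto simp: left_diff_distrib)
    also have "\<dots> \<le> \<epsilon> * arr \<omega> f n"
      using N[of n] False arr_pos[of f n] by (intro mult_right_mono) auto
    finally show ?thesis by (simp add: add_increasing2 sum_nonneg)
  qed
  thus ?thesis by (intro exI[of _ "sum ?d {..<N}"]) (auto simp: sum_nonneg)
qed

lemma rate_le_cnt: "rate_le (\<lambda>k. ct k f) (r f)"
  unfolding rate_le_def
proof (intro allI impI)
  fix \<epsilon> :: real assume \<epsilon>: "0 < \<epsilon>"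
  obtain C where C: "C \<ge> 0" "\<And>n. \<bar>real (Suc n) - r f * arr \<omega> f n\<bar> \<le> \<epsilon> * arr \<omega> f n + C"
    using arr_rate[OF \<epsilon>] by blast
  have "ct k f \<le> (r f + \<epsilon>) * \<tau> k + C" for k
  proof (cases "cnt (st k) f")
    case 0
    thus ?thesis using C(1) \<epsilon> rate_pos[of f] evtime_pos[of k] by simp
  next
    case (Suc n)
    have "ct k f \<le> (r f + \<epsilon>) * arr \<omega> f n + C"
      using C(2)[of n] unfolding Suc by (simp add: distrib_right)
    also have "(r f + \<epsilon>) * arr \<omega> f n \<le> (r f + \<epsilon>) * \<tau> k"
      using \<epsilon> rate_pos[of f] Suc by (intro mult_left_mono arr_processed_le) auto
    finally show ?thesis by simp
  qed
  thus "\<exists>C\<ge>0. \<forall>k. ct k f \<le> (r f + \<epsilon>) * \<tau> k + C" using C(1) by blast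
qed

text \<open>The next point of f has index \<open>cnt (st k) f\<close> and is not before
  \<open>\<tau> k\<close>; counting it in costs the extra 1 in the constant.\<close>

lemma rate_ge_cnt: "rate_ge (\<lambda>k. ct k f) (r f)"
  unfolding rate_ge_def
proof (intro allI impI)
  fix \<epsilon> :: real assume \<epsilon>: "0 < \<epsilon>"
  obtain C where C: "C \<ge> 0" "\<And>n. \<bar>real (Suc n) - r f * arr \<omega> f n\<bar> \<le> \<epsilon> * arr \<omega> f n + C"
    using arr_rate[OF \<epsilon>] by blast
  have "(r f - \<epsilon>) * \<tau> k - (C + 1) \<le> ct k f" for k
  proof (cases "\<epsilon> < r f")
    case False
    hence "(r f - \<epsilon>) * \<tau> k \<le> 0"
      using evtime_pos[of k] by (intro mult_nonpos_nonneg) auto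
    thus ?thesis using C(1) by (smt (verit) of_nat_0_le_iff)
  next
    case True
    hence "(r f - \<epsilon>) * \<tau> k \<le> (r f - \<epsilon>) * arr \<omega> f (cnt (st k) f)"
      by (intro mult_left_mono evtime_le_arr) auto
    also have "\<dots> \<le> ct k f + 1 + C"
      using C(2)[of "cnt (st k) f"] by (simp add: left_diff_distrib)
    finally show ?thesis by simp
  qed
  thus "\<exists>C\<ge>0. \<forall>k. (r f - \<epsilon>) * \<tau> k - C \<le> ct k f"
    using C(1) by (intro exI[of _ "C + 1"]) auto
qed

lemma rate_le_add_const:
  assumes "rate_le x \<mu>" shows "rate_le (\<lambda>k. c + x k) \<mu>"
  unfolding rate_le_def
proof (intro allI impI)
  fix \<epsilon> :: real assume "0 < \<epsilon>"
  then obtain C where C: "C \<ge> 0" "\<And>k. x k \<le> (\<mu> + \<epsilon>) * \<tau> k + C"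
    using assms by (auto simp: rate_le_def)
  have "c + x k \<le> (\<mu> + \<epsilon>) * \<tau> k + (C + \<bar>c\<bar>)" for k
    using C(2)[of k] by linarith
  thus "\<exists>C\<ge>0. \<forall>k. c + x k \<le> (\<mu> + \<epsilon>) * \<tau> k + C"
    using C(1) by (intro exI[of _ "C + \<bar>c\<bar>"]) auto
qed

lemma rate_ge_add_const:
  assumes "rate_ge x \<mu>" shows "rate_ge (\<lambda>k. c + x k) \<mu>"
  unfolding rate_ge_def
proof (intro allI impI)
  fix \<epsilon> :: real assume "0 < \<epsilon>"
  then obtain C where C: "C \<ge> 0" "\<And>k. (\<mu> - \<epsilon>) * \<tau> k - C \<le> x k"
    using assms by (auto simp: rate_ge_def)
  have "(\<mu> - \<epsilon>) * \<tau> k - (C + \<bar>c\<bar>) \<le> c + x k" for k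
    using C(2)[of k] by linarith
  thus "\<exists>C\<ge>0. \<forall>k. (\<mu> - \<epsilon>) * \<tau> k - C \<le> c + x k"
    using C(1) by (intro exI[of _ "C + \<bar>c\<bar>"]) auto
qed

lemma rate_ge_min:
  assumes "rate_ge x \<mu>" "rate_ge y \<nu>" shows "rate_ge (\<lambda>k. min (x k) (y k)) (min \<mu> \<nu>)"
  unfolding rate_ge_def
proof (intro allI impI)
  fix \<epsilon> :: real assume "0 < \<epsilon>"
  then obtain C D where C: "C \<ge> 0" "\<And>k. (\<mu> - \<epsilon>) * \<tau> k - C \<le> x k"
      and D: "D \<ge> 0" "\<And>k. (\<nu> - \<epsilon>) * \<tau> k - D \<le> y k"
    using assms unfolding rate_ge_def by metis
  have "(min \<mu> \<nu> - \<epsilon>) * \<tau> k - (C + D) \<le> min (x k) (y k)" for k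
  proof -
    have "(min \<mu> \<nu> - \<epsilon>) * \<tau> k \<le> (\<mu> - \<epsilon>) * \<tau> k" "(min \<mu> \<nu> - \<epsilon>) * \<tau> k \<le> (\<nu> - \<epsilon>) * \<tau> k"
      using evtime_pos[of k] by (auto intro!: mult_right_mono)
    thus ?thesis using C(1) C(2)[of k] D(1) D(2)[of k] by linarith
  qed
  thus "\<exists>C\<ge>0. \<forall>k. (min \<mu> \<nu> - \<epsilon>) * \<tau> k - C \<le> min (x k) (y k)"
    using C(1) D(1) by (intro exI[of _ "C + D"]) auto
qed

lemma rate_le_min:
  assumes "rate_le x \<mu>" "rate_le x \<nu>" shows "rate_le x (min \<mu> \<nu>)"
  using assms by (auto simp: min_def)

text \<open>Here g drives x, and y is the barrier below which reflection never pushes it. A step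
  takes \<open>x k - ct k g\<close> no lower than the minimum of itself and
  \<open>y k - ct k g\<close>. The latter lies above a line in \<open>\<tau> k\<close> of
  nonpositive slope; as this line descends along the events, the bound is inherited by
  induction.\<close>

lemma rate_ge_reflected:
  assumes step: "\<And>k. min (x k) (y k) - ct k g \<le> x (Suc k) - ct (Suc k) g"
    and y: "rate_ge y \<mu>"
  shows "rate_ge x (min (r g) \<mu>)"
  unfolding rate_ge_def
proof (intro allI impI)
  fix \<epsilon> :: real assume \<epsilon>: "0 < \<epsilon>"
  hence \<epsilon>3: "0 < \<epsilon> / 3" by simp
  obtain C1 where C1: "C1 \<ge> 0" "\<And>k. (\<mu> - \<epsilon> / 3) * \<tau> k - C1 \<le> y k"
    using y \<epsilon>3 unfolding rate_ge_def by meson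
  obtain C2 where C2: "C2 \<ge> 0" "\<And>k. ct k g \<le> (r g + \<epsilon> / 3) * \<tau> k + C2"
    using rate_le_cnt[of g] \<epsilon>3 unfolding rate_le_def by meson
  obtain C3 where C3: "C3 \<ge> 0" "\<And>k. (r g - \<epsilon> / 3) * \<tau> k - C3 \<le> ct k g"
    using rate_ge_cnt[of g] \<epsilon>3 unfolding rate_ge_def by meson
  \<comment> \<open>Two thirds of \<epsilon> pay for the lower bound on y and the upper bound on the
    count of g; the last third is spent when that count is added back.\<close>
  define m where "m = min (r g) \<mu> - r g - 2 * \<epsilon> / 3"
  define D where "D = C1 + C2 + \<bar>x 0 - ct 0 g\<bar>"
  have m: "m \<le> 0" using \<epsilon> by (simp add: m_def)
  have z: "m * \<tau> k - D \<le> x k - ct k g" for k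
  proof (induction k)
    case 0
    have "m * \<tau> 0 \<le> 0" using m evtime_pos[of 0] by (intro mult_nonpos_nonneg) auto
    thus ?case using C1(1) C2(1) unfolding D_def by linarith
  next
    case (Suc k)
    have "m * \<tau> k \<le> (\<mu> - r g - 2 * \<epsilon> / 3) * \<tau> k"
      using evtime_pos[of k] by (intro mult_right_mono) (auto simp: m_def)
    also have "\<dots> = (\<mu> - \<epsilon> / 3) * \<tau> k - (r g + \<epsilon> / 3) * \<tau> k"
      by (simp add: algebra_simps)
    finally have "m * \<tau> k - D \<le> y k - ct k g"
      using C1(2)[of k] C2(2)[of k] unfolding D_def by linarith
    moreover have "m * \<tau> (Suc k) \<le> m * \<tau> k"
      using m monoD[OF mono_evtime, of k "Suc k"] by (intro mult_left_mono_neg) auto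
    ultimately show ?case using Suc step[of k] by linarith
  qed
  have "(min (r g) \<mu> - \<epsilon>) * \<tau> k - (D + C3) \<le> x k" for k
  proof -
    have "(min (r g) \<mu> - \<epsilon>) * \<tau> k = m * \<tau> k + (r g - \<epsilon> / 3) * \<tau> k"
      by (simp add: m_def algebra_simps)
    thus ?thesis using z[of k] C3(2)[of k] by linarith
  qed
  thus "\<exists>C\<ge>0. \<forall>k. (min (r g) \<mu> - \<epsilon>) * \<tau> k - C \<le> x k"
    using C1(1) C2(1) C3(1) by (intro exI[of _ "D + C3"]) (auto simp: D_def)
qed

text \<open>At the last event j of flow h before k, x is brought to at most \<open>y j\<close>; from
  then on it gains at most the later points of g. The points of h have positive density, so the
  elapsed time is o(\<open>\<tau> k\<close>), and so is the gain.\<close>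

lemma rate_le_reflected:
  assumes dec: "\<And>k. x (Suc k) - ct (Suc k) g \<le> x k - ct k g"
    and msg: "\<And>k. fl k = h \<Longrightarrow> x (Suc k) \<le> y k"
    and gh: "g \<noteq> h" and \<mu>: "0 < \<mu>" and y: "rate_le y \<mu>"
  shows "rate_le x (min (r g) \<mu>)"
proof (rule rate_le_min)
  have anti: "x k - ct k g \<le> x j - ct j g" if "j \<le> k" for j k
    using that dec by (rule lift_Suc_antimono_le[of "\<lambda>k. x k - ct k g", rotated])
  have cx: "x k \<le> x 0 + ct k g" for k
    using anti[of 0 k] by (simp add: cinit_def)
  have "rate_le (\<lambda>k. x 0 + ct k g) (r g)"
    by (intro rate_le_add_const rate_le_cnt)
  thus g: "rate_le x (r g)"
    unfolding rate_le_def using cx by (meson order_trans)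
  show "rate_le x \<mu>"
    unfolding rate_le_def
  proof (intro allI impI)
    fix \<epsilon> :: real assume \<epsilon>: "0 < \<epsilon>"
    \<comment> \<open>q converts elapsed time measured in expected points of h into expected points
      of g.\<close>
    define q where "q = r g / r h"
    have q: "0 < q" "q * r h = r g" using rate_pos[of g] rate_pos[of h] by (auto simp: q_def)
    \<comment> \<open>The final slope error is 3 \<delta> from y and the two counts of g, plus 2 q
      \<delta> from the gap between \<open>\<tau> j\<close> and \<open>\<tau> k\<close>. The cap
      \<open>r h / 2\<close> keeps the lower slope of the count of h away from 0.\<close>
    define \<delta> where "\<delta> = min (r h / 2) (\<epsilon> / (3 + 2 * q))"
    have \<delta>: "0 < \<delta>" "\<delta> \<le> r h / 2" unfolding \<delta>_def using rate_pos[of h] \<epsilon> q by (simp, intro min.cobounded1)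
    have "\<delta> \<le> \<epsilon> / (3 + 2 * q)" by (simp add: \<delta>_def)
    hence \<delta>\<epsilon>: "\<delta> * (3 + 2 * q) \<le> \<epsilon>" using q by (simp add: field_simps)
    obtain C1 where C1: "C1 \<ge> 0" "\<And>k. y k \<le> (\<mu> + \<delta>) * \<tau> k + C1"
      using y \<delta> unfolding rate_le_def by meson
    obtain C2 where C2: "C2 \<ge> 0" "\<And>k. ct k g \<le> (r g + \<delta>) * \<tau> k + C2"
      using rate_le_cnt[of g] \<delta> unfolding rate_le_def by meson
    obtain C3 where C3: "C3 \<ge> 0" "\<And>k. (r g - \<delta>) * \<tau> k - C3 \<le> ct k g"
      using rate_ge_cnt[of g] \<delta> unfolding rate_ge_def by meson
    obtain C4 where C4: "C4 \<ge> 0" "\<And>k. ct k h \<le> (r h + \<delta>) * \<tau> k + C4"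
      using rate_le_cnt[of h] \<delta> unfolding rate_le_def by meson
    obtain C5 where C5: "C5 \<ge> 0" "\<And>k. (r h - \<delta>) * \<tau> k - C5 \<le> ct k h"
      using rate_ge_cnt[of h] \<delta> unfolding rate_ge_def by meson
    define D where "D = \<bar>x 0\<bar> + (r g + \<delta>) * (2 * C5 / r h) + C2"
    define E where "E = C1 + C2 + C3 + q * (C4 + C5 + 1)"
    have "0 \<le> (r g + \<delta>) * (2 * C5 / r h)"
      using \<delta> C5(1) rate_pos[of g] rate_pos[of h] by simp
    hence D: "0 \<le> D" using C2(1) by (simp add: D_def)
    have E: "0 \<le> E" using C1(1) C2(1) C3(1) C4(1) C5(1) q by (simp add: E_def)
    have "x k \<le> (\<mu> + \<epsilon>) * \<tau> k + (D + E)" for k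
    proof (cases "cnt (st k) h")
      \<comment> \<open>Before the first point of h the time \<open>\<tau> k\<close> is bounded by a
        constant, and D is the resulting bound on x.\<close>
      case 0
      have "r h / 2 * \<tau> k \<le> (r h - \<delta>) * \<tau> k"
        using \<delta> evtime_pos[of k] by (intro mult_right_mono) auto
      also have "\<dots> \<le> C5" using C5(2)[of k] 0 by simp
      finally have "\<tau> k \<le> 2 * C5 / r h"
        using rate_pos[of h] by (simp add: field_simps)
      hence "(r g + \<delta>) * \<tau> k \<le> (r g + \<delta>) * (2 * C5 / r h)"
        using \<delta> rate_pos[of g] by (intro mult_left_mono) auto
      hence "x k \<le> D" using cx[of k] C2(2)[of k] unfolding D_def by linarith
      moreover have "0 \<le> (\<mu> + \<epsilon>) * \<tau> k" using \<mu> \<epsilon> evtime_pos[of k] by simp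
      ultimately show ?thesis using E by linarith
    next
      case (Suc n)
      then obtain j where j: "j < k" "fl j = h" "cnt (st k) h = Suc (cnt (st j) h)"
        using last_event[of k h] by auto
      have \<tau>: "\<tau> j \<le> \<tau> k" using j by (intro monoD[OF mono_evtime]) auto
      hence d\<tau>: "\<delta> * \<tau> j \<le> \<delta> * \<tau> k" using \<delta> by simp
      \<comment> \<open>Event j is the only point of h processed between \<open>st j\<close> and
        \<open>st k\<close>, so the linear bounds on the count of h control
        \<open>\<tau> k - \<tau> j\<close>.\<close>
      have "(r h - \<delta>) * \<tau> k - C5 \<le> (r h + \<delta>) * \<tau> j + C4 + 1"
        using C5(2)[of k] C4(2)[of j] j(3) by simp
      hence "r h * (\<tau> k - \<tau> j) \<le> 2 * (\<delta> * \<tau> k) + (C4 + C5 + 1)"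
        using d\<tau> by (simp add: algebra_simps)
      hence "q * (r h * (\<tau> k - \<tau> j)) \<le> q * (2 * (\<delta> * \<tau> k) + (C4 + C5 + 1))"
        using q by (intro mult_left_mono) auto
      hence gap: "r g * (\<tau> k - \<tau> j) \<le> 2 * q * \<delta> * \<tau> k + q * (C4 + C5 + 1)"
        unfolding mult.assoc[symmetric] q by (simp add: algebra_simps)
      have "x k - ct k g \<le> x (Suc j) - ct (Suc j) g"
        using j by (intro anti) auto
      also have "\<dots> \<le> y j - ct j g"
        using msg[OF j(2)] gh j(2) by (simp add: cnt_crun_Suc)
      finally have "x k \<le> y j + ct k g - ct j g" by simp
      also have "\<dots> \<le> (\<mu> + \<delta>) * \<tau> j + C1 + ((r g + \<delta>) * \<tau> k + C2) - ((r g - \<delta>) * \<tau> j - C3)"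
        using C1(2)[of j] C2(2)[of k] C3(2)[of j] by linarith
      also have "\<dots> = (\<mu> + \<delta>) * \<tau> j + \<delta> * \<tau> j + \<delta> * \<tau> k + r g * (\<tau> k - \<tau> j) + (C1 + C2 + C3)"
        by (simp add: algebra_simps)
      also have "\<dots> \<le> (\<mu> + \<delta>) * \<tau> k + \<delta> * \<tau> k + \<delta> * \<tau> k + (2 * q * \<delta> * \<tau> k + q * (C4 + C5 + 1)) + (C1 + C2 + C3)"
        using \<mu> \<delta> \<tau> d\<tau> gap by (intro add_mono mult_left_mono) auto
      also have "\<dots> = (\<mu> + \<delta> * (3 + 2 * q)) * \<tau> k + E"
        by (simp add: E_def algebra_simps)
      also have "\<dots> \<le> (\<mu> + \<epsilon>) * \<tau> k + E"
        using \<delta>\<epsilon> evtime_pos[of k] by (intro add_mono mult_right_mono) auto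
      finally show ?thesis using D by linarith
    qed
    thus "\<exists>C\<ge>0. \<forall>k. x k \<le> (\<mu> + \<epsilon>) * \<tau> k + C"
      using D E by (intro exI[of _ "D + E"]) auto
  qed
qed

section \<open>Rates of the three processors\<close>

lemma cx1_eq: "cx1 (st k) = fst x0 + int (cnt (st k) L1)"
proof (induction k)
  case (Suc k)
  thus ?case by (cases "fl k") (auto simp: crun_Suc_eq cstep_def Let_def)
qed (simp add: cinit_def)

lemma rate_cx1: "rate_le (\<lambda>k. real_of_int (cx1 (st k))) (r L1)"
    "rate_ge (\<lambda>k. real_of_int (cx1 (st k))) (r L1)"
  by (simp_all add: cx1_eq rate_le_add_const rate_ge_add_const rate_le_cnt rate_ge_cnt)

lemma rate_cx2: "rate_le (\<lambda>k. real_of_int (cx2 (st k))) (min (r L2) (r L1))"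
    "rate_ge (\<lambda>k. real_of_int (cx2 (st k))) (min (r L2) (r L1))"
proof -
  show "rate_le (\<lambda>k. real_of_int (cx2 (st k))) (min (r L2) (r L1))"
  proof (rule rate_le_reflected[OF _ _ _ _ rate_cx1(1)])
    show "real_of_int (cx2 (st (Suc k))) - ct (Suc k) L2 \<le> real_of_int (cx2 (st k)) - ct k L2" for k
      by (cases "fl k") (auto simp: crun_Suc_eq cstep_def Let_def)
    show "fl k = B12 \<Longrightarrow> real_of_int (cx2 (st (Suc k))) \<le> real_of_int (cx1 (st k))" for k
      by (auto simp: crun_Suc_eq cstep_def Let_def)
  qed (auto simp: rate_pos)
  show "rate_ge (\<lambda>k. real_of_int (cx2 (st k))) (min (r L2) (r L1))"
  proof (rule rate_ge_reflected[OF _ rate_cx1(2)])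
    show "min (real_of_int (cx2 (st k))) (real_of_int (cx1 (st k))) - ct k L2
        \<le> real_of_int (cx2 (st (Suc k))) - ct (Suc k) L2" for k
      by (cases "fl k") (auto simp: crun_Suc_eq cstep_def Let_def)
  qed
qed

lemma msgs2_time_le: "m \<in> set (msgs2 (st k)) \<Longrightarrow> fst m \<le> \<tau> k"
proof (induction k)
  case (Suc k)
  have "m \<in> set (msgs2 (st k)) \<or> fst m = \<tau> k"
    using Suc.prems by (cases "fl k") (auto simp: crun_Suc_eq cstep_def Let_def split: if_splits)
  thus ?case using Suc.IH monoD[OF mono_evtime, of k "Suc k"] by auto
qed (simp add: cinit_def)

lemma msgs_above_crun: "msgs_above (st k)"
proof (induction k)
  case 0
  show ?case by (simp add: cinit_def msgs_above_def)
next
  case (Suc k)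
  have "msgs_above (cstep (fl k) (\<tau> k) (st k))"
    using Suc msgs2_time_le by (rule msgs_above_cstep)
  thus ?case by (simp add: crun_Suc_eq msgs_above_def sent_after_last_jump_def)
qed

lemma rate_cx3: "rate_le (\<lambda>k. real_of_int (cx3 (st k))) (min (r L3) (min (r L2) (r L1)))"
    "rate_ge (\<lambda>k. real_of_int (cx3 (st k))) (min (r L3) (min (r L2) (r L1)))"
proof -
  show "rate_le (\<lambda>k. real_of_int (cx3 (st k))) (min (r L3) (min (r L2) (r L1)))"
  proof (rule rate_le_reflected[OF _ _ _ _ rate_cx2(1)])
    show "real_of_int (cx3 (st (Suc k))) - ct (Suc k) L3 \<le> real_of_int (cx3 (st k)) - ct k L3" for k
    proof (cases "fl k")
      case B12
      thus ?thesis by (simp add: crun_Suc_eq cx3_cstep_B12_le)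
    qed (auto simp: crun_Suc_eq cstep_def)
    show "fl k = B23 \<Longrightarrow> real_of_int (cx3 (st (Suc k))) \<le> real_of_int (cx2 (st k))" for k
      by (auto simp: crun_Suc_eq cstep_def)
  qed (auto simp: rate_pos)
  \<comment> \<open>A message pushes \<open>cx3\<close> no lower than \<open>cx2\<close>, a
    cascading rollback no lower than \<open>cx1\<close>, so the barrier is the minimum of both. Its
    rate is still \<open>min (r L2) (r L1)\<close>, because the rate of \<open>cx2\<close> is
    already at most \<open>r L1\<close>.\<close>
  have "rate_ge (\<lambda>k. real_of_int (cx3 (st k))) (min (r L3) (min (min (r L2) (r L1)) (r L1)))"
  proof (rule rate_ge_reflected[OF _ rate_ge_min[OF rate_cx2(2) rate_cx1(2)]])
    show "min (real_of_int (cx3 (st k))) (min (real_of_int (cx2 (st k))) (real_of_int (cx1 (st k))))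
        - ct k L3 \<le> real_of_int (cx3 (st (Suc k))) - ct (Suc k) L3" for k
    proof (cases "fl k")
      case B12
      have "min (cx3 (st k)) (cx1 (st k)) \<le> cx3 (cstep B12 (\<tau> k) (st k))"
        by (rule cx3_cstep_B12_ge[OF msgs_above_crun])
      hence "min (cx3 (st k)) (min (cx2 (st k)) (cx1 (st k))) \<le> cx3 (st (Suc k))"
        by (simp add: crun_Suc_eq B12)
      moreover have "ct (Suc k) L3 = ct k L3" by (simp add: cnt_crun_Suc B12)
      ultimately show ?thesis by (simp only: of_int_min[symmetric])
    qed (auto simp: crun_Suc_eq cstep_def)
  qed
  thus "rate_ge (\<lambda>k. real_of_int (cx3 (st k))) (min (r L3) (min (r L2) (r L1)))"
    by (simp add: min.assoc)
qed

section \<open>From event indices to real time\<close>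

lemma filterlim_evtime: "filterlim \<tau> at_top sequentially"
proof -
  \<comment> \<open>Events do not accumulate: k is the total number of processed points, which is at
    most linear in \<open>\<tau> k\<close>.\<close>
  have "\<forall>f. \<exists>C. \<forall>k. ct k f \<le> (r f + 1) * \<tau> k + C"
    using rate_le_cnt unfolding rate_le_def by (meson zero_less_one)
  then obtain C where C: "\<And>f k. ct k f \<le> (r f + 1) * \<tau> k + C f"
    by metis
  define A where "A = (\<Sum>f\<in>UNIV. r f + 1)"
  define B where "B = sum C UNIV"
  have A: "0 < A" unfolding A_def
    using rate_pos finite by (intro sum_pos) (auto intro: add_pos_pos)
  have "(real k - B) / A \<le> \<tau> k" for k
  proof -
    have "real k = (\<Sum>f\<in>UNIV. ct k f)"
      using sum_cnt[of k] by (metis of_nat_sum)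
    also have "\<dots> \<le> (\<Sum>f\<in>UNIV. (r f + 1) * \<tau> k + C f)"
      by (intro sum_mono C)
    also have "\<dots> = A * \<tau> k + B"
      unfolding A_def B_def by (subst sum.distrib) (simp only: sum_distrib_right)
    finally show ?thesis using A by (simp add: field_simps)
  qed
  moreover have "filterlim (\<lambda>k. (real k - B) / A) at_top sequentially"
    using A by real_asymp
  ultimately show ?thesis
    by (auto intro: filterlim_at_top_mono)
qed

lemma tendsto_rate:
  assumes "rate_le x \<mu>" "rate_ge x \<mu>"
  shows "(\<lambda>k. x k / \<tau> k) \<longlonglongrightarrow> \<mu>"
proof (rule tendstoI)
  fix e :: real assume "0 < e"
  hence e: "0 < e / 2" by simp
  obtain C where C: "\<And>k. x k \<le> (\<mu> + e / 2) * \<tau> k + C"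
    using assms(1) e unfolding rate_le_def by meson
  obtain D where D: "\<And>k. (\<mu> - e / 2) * \<tau> k - D \<le> x k"
    using assms(2) e unfolding rate_ge_def by meson
  have "\<forall>\<^sub>F k in sequentially. 2 * (\<bar>C\<bar> + \<bar>D\<bar>) / e < \<tau> k"
    using filterlim_evtime by (simp add: filterlim_at_top_dense)
  thus "\<forall>\<^sub>F k in sequentially. dist (x k / \<tau> k) \<mu> < e"
  proof eventually_elim
    case (elim k)
    hence "\<bar>C\<bar> + \<bar>D\<bar> < e / 2 * \<tau> k" using \<open>0 < e\<close> by (simp add: field_simps)
    hence "\<bar>x k - \<mu> * \<tau> k\<bar> < e * \<tau> k"
      using C[of k] D[of k] by (simp add: algebra_simps)
    hence "\<bar>x k - \<mu> * \<tau> k\<bar> / \<tau> k < e" using evtime_pos[of k] by (simp add: field_simps)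
    moreover have "\<bar>x k - \<mu> * \<tau> k\<bar> / \<tau> k = \<bar>x k / \<tau> k - \<mu>\<bar>"
      using evtime_pos[of k] by (simp add: abs_div_pos diff_divide_distrib)
    ultimately show ?case by (simp add: dist_real_def)
  qed
qed

text \<open>One event adds at most one point of \<open>L1\<close>, while the number of these points
  grows linearly in time; gaps between events that are not o(\<open>\<tau> k\<close>) would
  contradict this.\<close>

lemma tendsto_evtime_ratio: "(\<lambda>k. \<tau> (Suc k) / \<tau> k) \<longlonglongrightarrow> 1"
proof (rule tendsto_rate)
  show "rate_ge (\<lambda>k. \<tau> (Suc k)) 1"
    unfolding rate_ge_def
  proof (intro allI impI exI[of _ 0] conjI)
    fix \<epsilon> :: real and k assume "0 < \<epsilon>"
    hence "(1 - \<epsilon>) * \<tau> k \<le> 1 * \<tau> k" using evtime_pos[of k] by (intro mult_right_mono) auto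
    thus "(1 - \<epsilon>) * \<tau> k - 0 \<le> \<tau> (Suc k)" using monoD[OF mono_evtime, of k "Suc k"] by simp
  qed simp
  show "rate_le (\<lambda>k. \<tau> (Suc k)) 1"
    unfolding rate_le_def
  proof (intro allI impI)
    fix \<epsilon> :: real assume \<epsilon>: "0 < \<epsilon>"
    let ?r = "r L1"
    \<comment> \<open>This solves
      \<open>(?r + \<delta>) / (?r - \<delta>) = 1 + \<epsilon>\<close>.\<close>
    define \<delta> where "\<delta> = \<epsilon> * ?r / (2 + \<epsilon>)"
    have \<delta>: "0 < \<delta>" using \<epsilon> rate_pos[of L1] by (simp add: \<delta>_def)
    have eq: "?r + \<delta> = (1 + \<epsilon>) * (?r - \<delta>)" using \<epsilon> by (simp add: \<delta>_def field_simps)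
    have r\<delta>: "0 < ?r - \<delta>" using eq \<delta> rate_pos[of L1] \<epsilon> by (metis add_pos_pos zero_less_mult_pos zero_less_one)
    obtain C where C: "C \<ge> 0" "\<And>k. ct k L1 \<le> (?r + \<delta>) * \<tau> k + C"
      using rate_le_cnt[of L1] \<delta> unfolding rate_le_def by meson
    obtain D where D: "D \<ge> 0" "\<And>k. (?r - \<delta>) * \<tau> k - D \<le> ct k L1"
      using rate_ge_cnt[of L1] \<delta> unfolding rate_ge_def by meson
    have "\<tau> (Suc k) \<le> (1 + \<epsilon>) * \<tau> k + (C + D + 1) / (?r - \<delta>)" for k
    proof -
      have "ct (Suc k) L1 \<le> ct k L1 + 1" by (simp add: cnt_crun_Suc)
      hence "(?r - \<delta>) * \<tau> (Suc k) \<le> (?r + \<delta>) * \<tau> k + (C + D + 1)"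
        using C(2)[of k] D(2)[of "Suc k"] by linarith
      also have "\<dots> = (?r - \<delta>) * ((1 + \<epsilon>) * \<tau> k + (C + D + 1) / (?r - \<delta>))"
        using r\<delta> by (subst distrib_left) (simp add: eq)
      finally show ?thesis using r\<delta> by simp
    qed
    thus "\<exists>C\<ge>0. \<forall>k. \<tau> (Suc k) \<le> (1 + \<epsilon>) * \<tau> k + C"
      using C(1) D(1) r\<delta> by (intro exI[of _ "(C + D + 1) / (?r - \<delta>)"]) auto
  qed
qed

lemma tendsto_rate_at_time:
  assumes "rate_le x \<mu>" "rate_ge x \<mu>"
  shows "((\<lambda>t. x (LEAST k. t \<le> \<tau> k) / t) \<longlongrightarrow> \<mu>) at_top"
proof -
  \<comment> \<open>\<open>K t\<close> counts the events strictly before t. Once it is positive, t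
    lies between \<open>\<tau> (K t - 1)\<close> and \<open>\<tau> (K t)\<close>, whose ratio tends
    to 1.\<close>
  define K where "K t = (LEAST k. t \<le> \<tau> k)" for t
  have K: "t \<le> \<tau> (K t)" for t
  proof -
    have "\<exists>k. t \<le> \<tau> k"
      using filterlim_evtime by (auto simp: filterlim_at_top eventually_sequentially)
    thus ?thesis unfolding K_def by (rule LeastI_ex)
  qed
  have K_less: "\<tau> k < t" if "k < K t" for k t
    using not_less_Least[of k "\<lambda>k. t \<le> \<tau> k"] that by (simp add: K_def)
  have K_gt: "Z < K t" if "\<tau> Z < t" for Z t
  proof (rule ccontr)
    assume "\<not> Z < K t"
    hence "\<tau> (K t) \<le> \<tau> Z" by (intro monoD[OF mono_evtime]) auto
    with K[of t] that show False by simp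
  qed
  have lim_K: "filterlim K at_top at_top"
    unfolding filterlim_at_top
  proof
    fix Z
    show "\<forall>\<^sub>F t in at_top. Z \<le> K t"
      using eventually_gt_at_top[of "\<tau> Z"] by eventually_elim (auto dest: K_gt)
  qed
  hence lim_K1: "filterlim (\<lambda>t. K t - 1) at_top at_top"
    by (rule filterlim_compose[OF filterlim_minus_const_nat_at_top])
  have "((\<lambda>t. \<tau> (K t) / t) \<longlongrightarrow> 1) at_top"
  proof (rule tendsto_sandwich[OF _ _ tendsto_const filterlim_compose[OF tendsto_evtime_ratio lim_K1]])
    show "\<forall>\<^sub>F t in at_top. 1 \<le> \<tau> (K t) / t"
      using eventually_gt_at_top[of 0] by eventually_elim (simp add: K)
    show "\<forall>\<^sub>F t in at_top. \<tau> (K t) / t \<le> \<tau> (Suc (K t - 1)) / \<tau> (K t - 1)"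
      using eventually_gt_at_top[of "\<tau> 0"]
    proof eventually_elim
      case (elim t)
      hence "0 < K t" by (rule K_gt)
      hence "Suc (K t - 1) = K t" "\<tau> (K t - 1) < t" using K_less[of "K t - 1" t] by auto
      moreover have "0 < t" using evtime_pos elim by (rule order_less_trans)
      ultimately show ?case
        using evtime_pos[of "K t"] evtime_pos[of "K t - 1"] by (simp add: divide_left_mono)
    qed
  qed
  from tendsto_mult[OF filterlim_compose[OF tendsto_rate[OF assms] lim_K] this]
  show ?thesis
    using evtime_pos[THEN less_imp_neq] by (simp add: K_def eq_commute[of 0])
qed

lemma tendsto_cpos:
  "((\<lambda>t. real_of_int (cpos x0 1 t \<omega>) / t) \<longlongrightarrow> r L1) at_top"
  "((\<lambda>t. real_of_int (cpos x0 2 t \<omega>) / t) \<longlongrightarrow> min (r L2) (r L1)) at_top"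
  "((\<lambda>t. real_of_int (cpos x0 3 t \<omega>) / t) \<longlongrightarrow> min (r L3) (min (r L2) (r L1))) at_top"
  using tendsto_rate_at_time[OF rate_cx1] tendsto_rate_at_time[OF rate_cx2]
    tendsto_rate_at_time[OF rate_cx3]
  by (simp_all add: cpos_def cstate_at_def Let_def)

end

end

section \<open>Measurability\<close>

text \<open>A state in which every time is replaced by the label (f, n) of the point of the flows that
  occurs at it. There are only countably many such states, and the labelled run depends on
  the sample only through comparisons of arrival times; this makes the process measurable.\<close>
type_synonym sym_state =
  "int \<times> int \<times> int \<times> ((flow \<times> nat) \<times> int) list \<times> ((flow \<times> nat) \<times> int) list \<times> (flow \<Rightarrow> nat)"

fun sym_step :: "(flow \<times> nat \<Rightarrow> real) \<Rightarrow> flow \<Rightarrow> sym_state \<Rightarrow> sym_state" where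
  "sym_step a f (x1, x2, x3, js, ms, c) = (let i = (f, c f); c' = c(f := Suc (c f)) in case f of
     L1 \<Rightarrow> (x1 + 1, x2, x3, js, ms, c')
   | L2 \<Rightarrow> (x1, x2 + 1, x3, (i, x2) # js, ms, c')
   | L3 \<Rightarrow> (x1, x2, x3 + 1, js, ms, c')
   | B23 \<Rightarrow> (x1, x2, min x3 x2, js, (i, x2) # ms, c')
   | B12 \<Rightarrow>
      (if x1 < x2 then
        (let canc = (\<lambda>m. a (fst m) < a i \<and> (case find (\<lambda>j. snd j = x1) js of
                      None \<Rightarrow> True | Some j \<Rightarrow> a (fst j) < a (fst m)))
         in (x1, x1, fold (\<lambda>(_, v) m. min m v) (filter canc ms) x3, js,
             filter (\<lambda>m. \<not> canc m) ms, c'))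
       else (x1, x2, x3, js, ms, c')))"

fun realize :: "(flow \<times> nat \<Rightarrow> real) \<Rightarrow> sym_state \<Rightarrow> cstate" where
  "realize a (x1, x2, x3, js, ms, c) = \<lparr>cx1 = x1, cx2 = x2, cx3 = x3,
     jumps2 = map (map_prod a id) js, msgs2 = map (map_prod a id) ms, cnt = c\<rparr>"

lemma find_map_map_prod:
  "find (\<lambda>(t, v). v = x) (map (map_prod a id) js) =
     map_option (map_prod a id) (find (\<lambda>j. snd j = x) js)"
  by (induction js) auto

lemma fold_min_map_map_prod:
  "fold (\<lambda>(_, v) m. min m v) (map (map_prod a id) C) x = fold (\<lambda>(_, v) m. min m v) C (x :: int)"
  by (induction C arbitrary: x) auto

text \<open>The labelled step compares labels through their times under \<open>a\<close>, so it
  commutes with replacing labels by these times, whatever \<open>a\<close> is.\<close>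

lemma realize_sym_step:
  "realize a (sym_step a f p) = (cstep f (a (f, cnt (realize a p) f)) (realize a p))
     \<lparr>cnt := (cnt (realize a p))(f := Suc (cnt (realize a p) f))\<rparr>"
proof (cases p)
  case (fields x1 x2 x3 js ms c)
  show ?thesis
  proof (cases f)
    case B12
    have canc: "sent_after_last_jump (realize a p) x1 (map_prod a id m) \<longleftrightarrow>
        (case find (\<lambda>j. snd j = x1) js of None \<Rightarrow> True | Some j \<Rightarrow> a (fst j) < a (fst m))" for m
      by (auto simp: sent_after_last_jump_def fields find_map_map_prod split: option.split)
    show ?thesis
      unfolding B12 cstep_B12
      using canc by (auto simp: fields filter_map comp_def fold_min_map_map_prod Let_def)
  qed (auto simp: fields cstep_def Let_def)
qed

definition flow_times :: "(flow \<times> nat \<Rightarrow> real) \<Rightarrow> flow \<times> nat \<Rightarrow> real" where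
  "flow_times \<omega> = (\<lambda>(f, n). arr \<omega> f n)"

text \<open>Going through \<open>nextf\<close> makes both runs resolve ties by the same choice; they
  then agree for every sample, not just almost surely.\<close>

definition sym_next :: "(flow \<times> nat \<Rightarrow> real) \<Rightarrow> sym_state \<Rightarrow> flow" where
  "sym_next \<omega> p = nextf \<omega> (realize (flow_times \<omega>) p)"

primrec sym_run :: "(flow \<times> nat \<Rightarrow> real) \<Rightarrow> int \<times> int \<times> int \<Rightarrow> nat \<Rightarrow> sym_state" where
  "sym_run \<omega> x0 0 = (fst x0, fst (snd x0), snd (snd x0), [], [], \<lambda>_. 0)"
| "sym_run \<omega> x0 (Suc k) =
     sym_step (flow_times \<omega>) (sym_next \<omega> (sym_run \<omega> x0 k)) (sym_run \<omega> x0 k)"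

lemma crun_eq_realize: "crun \<omega> x0 k = realize (flow_times \<omega>) (sym_run \<omega> x0 k)"
proof (induction k)
  case 0
  show ?case by (simp add: cinit_def)
next
  case (Suc k)
  show ?case
    by (simp add: Suc realize_sym_step sym_next_def Let_def) (simp add: flow_times_def)
qed

lemma measurable_filter_list:
  assumes "\<And>x. x \<in> set xs \<Longrightarrow> Measurable.pred M (\<lambda>\<omega>. P \<omega> x)"
  shows "(\<lambda>\<omega>. filter (P \<omega>) xs) \<in> measurable M (count_space UNIV)"
  using assms
proof (induction xs)
  case (Cons x xs)
  have [measurable]: "Measurable.pred M (\<lambda>\<omega>. P \<omega> x)"
    "(\<lambda>\<omega>. filter (P \<omega>) xs) \<in> measurable M (count_space UNIV)"
    using Cons by auto
  have "(\<lambda>\<omega>. x # filter (P \<omega>) xs) \<in> measurable M (count_space UNIV)"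
    by (rule measurable_compose[of _ M "count_space UNIV" "(#) x"]) auto
  thus ?case by simp
qed simp

lemma measurable_binary_count_space:
  fixes f :: "'a \<Rightarrow> 'b::countable"
  assumes f: "f \<in> measurable M (count_space UNIV)" and g: "g \<in> measurable M (count_space UNIV)"
  shows "(\<lambda>\<omega>. h (f \<omega>) (g \<omega>)) \<in> measurable M (count_space UNIV)"
  by (rule measurable_compose_countable[where f = "\<lambda>i \<omega>. h i (g \<omega>)", OF _ f])
     (rule measurable_compose[OF g], simp)

section \<open>Measurability of the labelled run and of the positions\<close>

context
  fixes M :: "(flow \<times> nat \<Rightarrow> real) measure"
  assumes coord [measurable]: "\<And>i. (\<lambda>\<omega>. \<omega> i) \<in> borel_measurable M"
begin

lemma measurable_arr [measurable]: "(\<lambda>\<omega>. arr \<omega> f n) \<in> borel_measurable M"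
  unfolding arr_def by measurable

lemma measurable_flow_times [measurable]: "(\<lambda>\<omega>. flow_times \<omega> i) \<in> borel_measurable M"
  unfolding flow_times_def by (cases i) simp

text \<open>\<open>arg_min\<close> is a Hilbert choice without explicit formula, but its result is a
  function of the set A of minimising flows alone. This set has finitely many possible values, each
  determined by comparing finitely many arrival times.\<close>

lemma measurable_sym_next: "(\<lambda>\<omega>. sym_next \<omega> p) \<in> measurable M (count_space UNIV)"
proof -
  obtain c where c: "\<And>a. cnt (realize a p) = c" by (cases p) auto
  define A where "A \<omega> = {f. \<forall>g. \<not> arr \<omega> g (c g) < arr \<omega> f (c f)}" for \<omega>
  have "A \<in> measurable M (count_space UNIV)"
  proof (subst measurable_count_space_eq2_countable, intro conjI ballI)
    fix B
    have "A -` {B} \<inter> space M =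
        {\<omega> \<in> space M. \<forall>f. (\<forall>g. \<not> arr \<omega> g (c g) < arr \<omega> f (c f)) \<longleftrightarrow> f \<in> B}"
      by (auto simp: A_def set_eq_iff)
    also have "\<dots> \<in> sets M"
      unfolding pred_def[symmetric]
      by (intro pred_intros_countable pred_intros_logic borel_measurable_pred_less measurable_arr measurable_const) simp
    finally show "A -` {B} \<inter> space M \<in> sets M" .
  qed auto
  moreover have "sym_next \<omega> p = (SOME f. f \<in> A \<omega>)" for \<omega>
    by (simp add: sym_next_def nextf_def c arg_min_def is_arg_min_def A_def not_less)
  ultimately show ?thesis
    by (simp add: measurable_compose[of A M "count_space UNIV" "\<lambda>A. SOME f. f \<in> A"])
qed

text \<open>Times enter only through cancellation; in every other case the step is constant in the
  sample. Under cancellation the sample matters only through the cancelled and the kept part of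
  \<open>ms\<close>.\<close>

lemma measurable_sym_step:
  "(\<lambda>\<omega>. sym_step (flow_times \<omega>) f p) \<in> measurable M (count_space UNIV)"
proof (cases p)
  case (fields x1 x2 x3 js ms c)
  show ?thesis
  proof (cases "f = B12 \<and> x1 < x2")
    case False
    thus ?thesis by (cases f) (auto simp: fields Let_def)
  next
    case True
    define canc where "canc \<omega> m \<longleftrightarrow> flow_times \<omega> (fst m) < flow_times \<omega> (f, c f) \<and>
      (case find (\<lambda>j. snd j = x1) js of None \<Rightarrow> True
       | Some j \<Rightarrow> flow_times \<omega> (fst j) < flow_times \<omega> (fst m))" for \<omega> and m :: "(flow \<times> nat) \<times> int"
    have [measurable]: "Measurable.pred M (\<lambda>\<omega>. canc \<omega> m)" for m
      unfolding canc_def by (cases "find (\<lambda>j. snd j = x1) js") simp_all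
    have "(\<lambda>\<omega>. filter (canc \<omega>) ms) \<in> measurable M (count_space UNIV)"
      "(\<lambda>\<omega>. filter (\<lambda>m. \<not> canc \<omega> m) ms) \<in> measurable M (count_space UNIV)"
      by (rule measurable_filter_list, measurable)+
    note measurable_binary_count_space[OF this,
      of "\<lambda>C D. (x1, x1, fold (\<lambda>(_, v) m. min m v) C x3, js, D, c(f := Suc (c f)))"]
    thus ?thesis using True
      by (simp add: fields Let_def canc_def[abs_def])
  qed
qed

text \<open>With countably many states and flows it suffices to treat each fixed current state and
  each fixed next flow.\<close>

lemma measurable_sym_run: "(\<lambda>\<omega>. sym_run \<omega> x0 k) \<in> measurable M (count_space UNIV)"
proof (induction k)
  case (Suc k)
  have "(\<lambda>\<omega>. sym_step (flow_times \<omega>) (sym_next \<omega> p) p) \<in> measurable M (count_space UNIV)" for p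
    by (rule measurable_compose_countable[where f = "\<lambda>f \<omega>. sym_step (flow_times \<omega>) f p"])
       (rule measurable_sym_step measurable_sym_next)+
  thus ?case
    using measurable_compose_countable[OF _ Suc,
        where f = "\<lambda>p \<omega>. sym_step (flow_times \<omega>) (sym_next \<omega> p) p"] by simp
qed simp

lemma measurable_evtime: "(\<lambda>\<omega>. evtime \<omega> x0 k) \<in> borel_measurable M"
proof -
  have "(\<lambda>\<omega>. flow_times \<omega> (sym_next \<omega> p, cnt (realize (flow_times \<omega>) p) (sym_next \<omega> p)))
      \<in> borel_measurable M" for p
  proof (cases p)
    case (fields x1 x2 x3 js ms c)
    show ?thesis
      using measurable_compose_countable[where f = "\<lambda>f \<omega>. flow_times \<omega> (f, c f)",
          OF measurable_flow_times measurable_sym_next]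
      by (simp add: fields)
  qed
  from measurable_compose_countable[OF this measurable_sym_run]
  show ?thesis by (simp add: evtime_def crun_eq_realize sym_next_def flow_times_def Let_def)
qed

lemma measurable_cpos: "(\<lambda>\<omega>. cpos x0 j t \<omega>) \<in> measurable M (count_space UNIV)"
proof -
  note measurable_evtime [measurable]
  define h :: "sym_state \<Rightarrow> int" where
    "h = (\<lambda>(x1, x2, x3, _). if j = 1 then x1 else if j = 2 then x2 else x3)"
  have "(\<lambda>\<omega>. h (sym_run \<omega> x0 k)) \<in> measurable M (count_space UNIV)" for k
    by (rule measurable_compose[OF measurable_sym_run]) simp
  moreover have "(\<lambda>\<omega>. LEAST k. t \<le> evtime \<omega> x0 k) \<in> measurable M (count_space UNIV)"
    by measurable
  ultimately have "(\<lambda>\<omega>. h (sym_run \<omega> x0 (LEAST k. t \<le> evtime \<omega> x0 k))) \<in> measurable M (count_space UNIV)"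
    by (rule measurable_compose_countable)
  moreover have "cpos x0 j t \<omega> = h (sym_run \<omega> x0 (LEAST k. t \<le> evtime \<omega> x0 k))" for \<omega>
    unfolding cpos_def cstate_at_def crun_eq_realize h_def
    by (cases "sym_run \<omega> x0 (LEAST k. t \<le> evtime \<omega> x0 k)") simp
  ultimately show ?thesis by simp
qed

end

section \<open>Convergence in probability and the four regimes\<close>

lemma conv_prob_if_AE_tendsto:
  assumes "prob_space M" and [measurable]: "\<And>t. X t \<in> borel_measurable M"
    and lim: "AE \<omega> in M. ((\<lambda>t. X t \<omega>) \<longlongrightarrow> c) at_top"
  shows "conv_prob M X c"
  unfolding conv_prob_def
proof (intro conjI allI impI)
  interpret prob_space M by fact
  fix e :: real assume e: "0 < e"
  define A where "A t = {\<omega> \<in> space M. e < \<bar>X t \<omega> - c\<bar>}" for t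
  have [measurable]: "A t \<in> sets M" for t unfolding A_def by measurable
  have "((\<lambda>t. measure M (A t)) \<longlongrightarrow> 0) at_top"
  \<comment> \<open>Dominated convergence is applied to sequences, so the limit over real t is
    tested along every sequence tending to infinity; the indicators are bounded by 1.\<close>
  proof (rule tendsto_at_topI_sequentially)
    fix T :: "nat \<Rightarrow> real" assume T: "filterlim T at_top sequentially"
    have "(\<lambda>n. \<integral>\<omega>. indicator (A (T n)) \<omega> \<partial>M) \<longlonglongrightarrow> (\<integral>\<omega>. (0::real) \<partial>M)"
    proof (rule integral_dominated_convergence[where w = "\<lambda>_. 1"])
      show "AE \<omega> in M. (\<lambda>n. indicator (A (T n)) \<omega> :: real) \<longlonglongrightarrow> 0"
        using lim
      proof eventually_elim
        case (elim \<omega>)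
        have "\<forall>\<^sub>F t in at_top. dist (X t \<omega>) c < e"
          using elim e by (rule tendstoD)
        hence "\<forall>\<^sub>F n in sequentially. dist (X (T n) \<omega>) c < e"
          using T by (rule eventually_compose_filterlim)
        hence "\<forall>\<^sub>F n in sequentially. indicator (A (T n)) \<omega> = (0::real)"
          by eventually_elim (auto simp: A_def dist_real_def)
        thus ?case by (rule tendsto_eventually)
      qed
    qed (auto simp: indicator_def)
    thus "(\<lambda>n. measure M (A (T n))) \<longlonglongrightarrow> 0"
      by simp
  qed
  thus "((\<lambda>t. measure M {\<omega> \<in> space M. e < \<bar>X t \<omega> - c\<bar>}) \<longlongrightarrow> 0) at_top"
    by (simp add: A_def)
qed simp

theorem theorem3:
  fixes l1 l2 l3 b12 b23 :: real and x0 :: "int \<times> int \<times> int"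
  assumes "0 < l1" "0 < l2" "0 < l3" "0 < b12" "0 < b23"
  defines "V \<equiv> speed l1 l2 l3 b12 b23 x0"
  shows "(l1 < min l2 l3 \<longrightarrow> V 1 l1 \<and> V 2 l1 \<and> V 3 l1)
       \<and> (l2 > l1 \<and> l1 > l3 \<longrightarrow> V 1 l1 \<and> V 2 l1 \<and> V 3 l3)
       \<and> (l2 < min l1 l3 \<longrightarrow> V 1 l1 \<and> V 2 l2 \<and> V 3 l2)
       \<and> (l1 > l2 \<and> l2 > l3 \<longrightarrow> V 1 l1 \<and> V 2 l2 \<and> V 3 l3)"
proof -
  define r where "r = flow_rate l1 l2 l3 b12 b23"
  have r: "0 < r f" for f
    unfolding r_def using assms(1-5) by (rule flow_rate_pos)
  have r_eq: "r L1 = l1" "r L2 = l2" "r L3 = l3"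
    by (simp_all add: r_def flow_rate_def)
  have V: "V j v" if "\<And>\<omega>. cascade_path \<omega> r \<Longrightarrow>
      ((\<lambda>t. real_of_int (cpos x0 j t \<omega>) / t) \<longlongrightarrow> v) at_top" for j v
    unfolding V_def speed_def r_def[symmetric]
  proof (rule conv_prob_if_AE_tendsto)
    show "prob_space (cascade_space r)" using r by (rule prob_space_cascade_space)
    show "(\<lambda>\<omega>. real_of_int (cpos x0 j t \<omega>) / t) \<in> borel_measurable (cascade_space r)" for t
      by (rule measurable_compose[OF measurable_cpos[OF measurable_coordinate[OF r]]]) simp
    show "AE \<omega> in cascade_space r. ((\<lambda>t. real_of_int (cpos x0 j t \<omega>) / t) \<longlongrightarrow> v) at_top"
      using AE_cascade_pos[OF r] AE_arr_strong_law[OF r]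
      by eventually_elim (rule that, simp add: cascade_path_def r)
  qed
  \<comment> \<open>Each of the four regimes decides which argument of these minima is
    attained.\<close>
  have "V 1 l1" "V 2 (min l2 l1)" "V 3 (min l3 (min l2 l1))"
    using cascade_path.tendsto_cpos[of _ r x0] by (auto simp: r_eq intro!: V)
  thus ?thesis
    by (auto simp: min_def split: if_splits)
qed

end
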